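(* Let $p$ be a prime, let $L,R\ge 1$ be integers, and let $c_{-L},\dots,c_R\in\mathbb{F}_p$ with $c_{-L}\neq 0$ and $c_R\neq 0$. Let $M$ be the $n\times n$ banded Toeplitz matrix with parameters $c_{-L},\dots,c_R$, assume $M$ is invertible, and let $B_{i,j}$ be the blocks of $M^{-1}$ of size $P(f)\times P(f)$. Then for all $1\le j<i\le\lfloor n/P(f)\rfloor$ one has $B_{i,j}=B_{2,1}$. Moreover, if $P(f)\nmid n$, then for all $1\le j\le\lfloor n/P(f)\rfloor$ the block $B_{\lceil n/P(f)\rceil,j}$ is equal to the submatrix formed by the upper $(n \bmod P(f))$ rows of $B_{2,1}$.
   Context: The banded Toeplitz matrix $M$ of order $n$ with parameters $c_{-L},\dots,c_R$ is the $n\times n$ matrix whose $(i,j)$ entry is $c_{j-i}$ if $-L\le j-i\le R$ and $0$ otherwise. The associated polynomial is $f(x)=c_R x^{L+R}+\cdots+c_{-L+1}x+c_{-L}\in\mathbb{F}_p[x]$, and its period is $P(f)=\min\{q\in\mathbb{Z}_{>0} : f(x)\mid x^q-1 \text{ in } \mathbb{F}_p[x]\}$. Block partition: starting from the top-left corner, $M^{-1}$ is partitioned into blocks $B_{i,j}$, $1\le i,j\le\lceil n/P(f)\rceil$, of size $P(f)\times P(f)$, where $B_{i,j}$ consists of rows $(i-1)P(f)+1,\dots,\min(iP(f),n)$ and columns $(j-1)P(f)+1,\dots,\min(jP(f),n)$ (so the last block row and column are smaller if $P(f)\nmid n$). *)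

theory Defs
  imports
    "Jordan_Normal_Form.Gauss_Jordan_Elimination"
    "Jordan_Normal_Form.DL_Submatrix"
    "Berlekamp_Zassenhaus.Finite_Field"
begin

(* Only the values of c on {- int L..int R} matter.  Matrix indices start at 0, but the entry
   depends on j - i alone. *)

definition banded_toeplitz :: "nat \<Rightarrow> nat \<Rightarrow> nat \<Rightarrow> (int \<Rightarrow> 'a::zero) \<Rightarrow> 'a mat" where
  "banded_toeplitz n L R c =
     mat n n (\<lambda>(i, j). if - int L \<le> int j - int i \<and> int j - int i \<le> int R
                        then c (int j - int i) else 0)"

definition toeplitz_poly :: "nat \<Rightarrow> nat \<Rightarrow> (int \<Rightarrow> 'a::comm_monoid_add) \<Rightarrow> 'a poly" where
  "toeplitz_poly L R c = (\<Sum>k\<le>L + R. monom (c (int k - int L)) k)"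

(* The set of admissible q is nonempty if f has a nonzero constant coefficient and the
   coefficients lie in a finite field; otherwise the value may be unspecified. *)

definition poly_period :: "'a::comm_ring_1 poly \<Rightarrow> nat" where
  "poly_period f = (LEAST q. 0 < q \<and> f dvd monom 1 q - 1)"

(* The block indices i and j start at 1, whereas the rows and columns of a matrix start at 0. *)

definition block :: "nat \<Rightarrow> 'a mat \<Rightarrow> nat \<Rightarrow> nat \<Rightarrow> 'a mat" where
  "block P A i j = submatrix A {(i - 1) * P..<min (i * P) (dim_row A)}
                               {(j - 1) * P..<min (j * P) (dim_col A)}"

definition upper_rows :: "nat \<Rightarrow> 'a mat \<Rightarrow> 'a mat" where
  "upper_rows r A = submatrix A {..<r} UNIV"

end

theory Submission
  imports Defs
begin

text \<open>
  Away from the diagonal, the equations \<open>M M\<^sup>-\<^sup>1 = 1\<close> and \<open>M\<^sup>-\<^sup>1 M = 1\<close> say that the columns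
  and the rows of the inverse satisfy the linear recurrence with characteristic polynomial \<open>f\<close>
  (rows, up to reversal).  Since \<open>f\<close> divides \<open>x\<^sup>P - 1\<close>, a combination of \<open>P - (L + R) + 1\<close>
  consecutive instances of the recurrence says that the entries at distance \<open>P\<close> agree.  Strictly
  below the diagonal blocks one can therefore translate by \<open>P\<close> in both directions.
\<close>

section \<open>Polynomial periods and periodic linear recurrences\<close>

lemma finite_poly_degree_less: "finite {p :: 'a::{finite, zero} poly. degree p < d}"
proof (rule finite_subset)
  show "{p :: 'a poly. degree p < d} \<subseteq> Poly ` {xs. set xs \<subseteq> UNIV \<and> length xs \<le> d}"
  proof
    fix p :: "'a poly"
    assume "p \<in> {p. degree p < d}"
    then have "length (coeffs p) \<le> d"
      by (cases "p = 0") (auto simp: length_coeffs)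
    then show "p \<in> Poly ` {xs. set xs \<subseteq> UNIV \<and> length xs \<le> d}"
      by (intro image_eqI[of _ _ "coeffs p"]) auto
  qed
qed (intro finite_imageI finite_lists_length_le, simp)

text \<open>A nonzero constant coefficient makes \<open>f\<close> coprime to x: in x * h = f * g the
  cofactor \<open>g\<close> must vanish at 0, so one factor x cancels at a time.\<close>

lemma dvd_monom_mult_cancel:
  fixes f h :: "'a::idom poly"
  assumes "coeff f 0 \<noteq> 0" and "f dvd monom 1 k * h"
  shows "f dvd h"
  using assms(2)
proof (induction k)
  case 0
  then show ?case by (simp add: monom_0)
next
  case (Suc k)
  then obtain g where g: "monom 1 (Suc k) * h = f * g" unfolding dvd_def by blast
  have "coeff (f * g) 0 = 0" by (simp flip: g add: coeff_mult)
  with assms(1) have "poly g 0 = 0" by (simp add: coeff_mult poly_0_coeff_0)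
  then obtain g' where g': "g = [:0, 1:] * g'" unfolding poly_eq_0_iff_dvd dvd_def by auto
  have "[:0, 1:] * (monom 1 k * h) = [:0, 1:] * (f * g')"
    using g by (simp add: monom_Suc g')
  then have "monom 1 k * h = f * g'" by simp
  then show ?case using Suc.IH by simp
qed

text \<open>Pigeonhole: there are finitely many residues modulo \<open>f\<close>, so two powers of x
  agree modulo \<open>f\<close>, and the smaller power cancels. This is what makes the
  \<open>LEAST\<close> in \<open>poly_period\<close> meaningful.\<close>

lemma ex_dvd_monom_minus_one:
  fixes f :: "'a::{finite, field_gcd} poly"
  assumes "coeff f 0 \<noteq> 0"
  shows "\<exists>q>0. f dvd monom 1 q - 1"
proof (cases "degree f = 0")
  case True
  then have "is_unit f" using assms by (metis is_unit_iff_degree coeff_0)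
  then show ?thesis by (intro exI[of _ 1]) (simp add: unit_imp_dvd)
next
  case False
  \<comment> \<open>As \<open>f\<close> is not constant here, a zero residue obeys the strict degree
    bound too.\<close>
  have "range (\<lambda>q::nat. monom 1 q mod f) \<subseteq> {p. degree p < degree f}"
  proof safe
    fix q :: nat
    have "monom 1 q mod f = 0 \<or> degree (monom 1 q mod f) < degree f"
      using False by (intro degree_mod_less) auto
    then show "degree (monom 1 q mod f) < degree f" using False by auto
  qed
  then have "finite (range (\<lambda>q::nat. monom 1 q mod f))"
    using finite_poly_degree_less finite_subset by blast
  then have "\<not> inj (\<lambda>q::nat. monom 1 q mod f)"
    using finite_imageD by blast
  then obtain a b :: nat where ab: "a < b" "monom 1 a mod f = monom 1 b mod f"
    unfolding inj_def by (metis linorder_neqE_nat)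
  then have "f dvd monom 1 b - monom 1 a" by (metis mod_eq_dvd_iff)
  also have "monom 1 b - monom 1 a = monom 1 a * (monom 1 (b - a) - 1 :: 'a poly)"
    using ab(1) by (simp add: algebra_simps mult_monom)
  finally have "f dvd monom 1 (b - a) - 1"
    using dvd_monom_mult_cancel assms by blast
  then show ?thesis using ab(1) by (intro exI[of _ "b - a"]) auto
qed

lemma poly_period:
  fixes f :: "'a::{finite, field_gcd} poly"
  assumes "coeff f 0 \<noteq> 0"
  shows "0 < poly_period f" and "f dvd monom 1 (poly_period f) - 1"
  using LeastI_ex[OF ex_dvd_monom_minus_one[OF assms]] by (auto simp: poly_period_def)

text \<open>Apply the linear functional sending x^k to \<open>u k\<close>. On \<open>f * g\<close>
  it gives a combination of instances of the recurrence, weighted by the coefficients of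
  \<open>g\<close>; on x^P - 1 it gives \<open>u P - u 0\<close>. Only windows inside 0..P occur, so
  a finite segment of a matrix row or column can serve as \<open>u\<close>.\<close>

lemma linear_recurrence_periodic:
  fixes f :: "'a::idom poly" and u :: "nat \<Rightarrow> 'a"
  assumes "f dvd monom 1 P - 1" and "0 < P"
    and rec: "\<And>t. t + degree f \<le> P \<Longrightarrow> (\<Sum>m\<le>degree f. coeff f m * u (t + m)) = 0"
  shows "u P = u 0"
proof -
  obtain g where g: "monom 1 P - 1 = f * g" using assms(1) unfolding dvd_def by blast
  have "coeff (monom 1 P - 1 :: 'a poly) P = 1" using assms(2) by simp
  then have nz: "f * g \<noteq> 0" using g by (metis coeff_0 zero_neq_one)
  have "degree (monom 1 P - 1 :: 'a poly) = P"
    using assms(2) by (subst diff_conv_add_uminus, subst degree_add_eq_left)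
      (auto simp: degree_monom_eq)
  then have deg: "degree g + degree f = P"
    using nz unfolding g by (simp add: degree_mult_eq)
  let ?F = "\<lambda>(i, j). coeff g i * (coeff f j * u (i + j))"
  \<comment> \<open>The index \<open>k\<close> is kept as \<open>i + (k - i)\<close> to match the
    shape of \<open>sum.triangle_reindex\<close>.\<close>
  have "(\<Sum>k<Suc P. coeff (monom 1 P - 1) k * u k)
      = (\<Sum>k<Suc P. \<Sum>i\<le>k. coeff g i * (coeff f (k - i) * u (i + (k - i))))"
    unfolding g mult.commute[of f] coeff_mult
    by (intro sum.cong refl) (simp add: sum_distrib_right mult.assoc)
  also have "\<dots> = sum ?F {(i, j). i + j < Suc P}"
    by (simp add: sum.triangle_reindex)
  \<comment> \<open>By \<open>deg\<close> the rectangle lies inside the triangle; outside the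
    rectangle one of the two coefficients is beyond its degree.\<close>
  also have "\<dots> = sum ?F ({..degree g} \<times> {..degree f})"
  proof (rule sum.mono_neutral_right)
    show "finite {(i, j). i + j < Suc P}"
      by (rule finite_subset[of _ "{..P} \<times> {..P}"]) auto
  qed (use deg in \<open>auto intro: le_degree\<close>)
  also have "\<dots> = (\<Sum>t\<le>degree g. coeff g t * (\<Sum>m\<le>degree f. coeff f m * u (t + m)))"
    by (simp add: sum.cartesian_product sum_distrib_left)
  also have "\<dots> = 0"
    using rec deg by (intro sum.neutral) auto
  finally have "(\<Sum>k<Suc P. coeff (monom 1 P - 1) k * u k) = 0" .
  moreover have "(\<Sum>k<Suc P. coeff (monom 1 P - 1) k * u k)
      = (\<Sum>k\<in>{0, P}. coeff (monom 1 P - 1) k * u k)"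
    by (rule sum.mono_neutral_right) (auto simp: coeff_monom coeff_1)
  ultimately show ?thesis using assms(2) by simp
qed

section \<open>Products with the band matrix as recurrences\<close>

lemma coeff_toeplitz_poly:
  "coeff (toeplitz_poly L R c) m = (if m \<le> L + R then c (int m - int L) else 0)"
  unfolding toeplitz_poly_def coeff_sum coeff_monom by (auto simp: sum.delta)

lemma degree_toeplitz_poly:
  assumes "c (int R) \<noteq> 0"
  shows "degree (toeplitz_poly L R c) = L + R"
proof (rule antisym)
  show "degree (toeplitz_poly L R c) \<le> L + R"
    by (rule degree_le) (simp add: coeff_toeplitz_poly)
  show "L + R \<le> degree (toeplitz_poly L R c)"
    using assms by (intro le_degree) (simp add: coeff_toeplitz_poly)
qed

lemma dim_banded_toeplitz [simp]:
  "dim_row (banded_toeplitz n L R c) = n" "dim_col (banded_toeplitz n L R c) = n"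
  by (simp_all add: banded_toeplitz_def)

text \<open>The offset \<open>L\<close> makes the band of the row start at column \<open>t\<close>;
  the assumption keeps the whole band inside the matrix.\<close>

lemma banded_toeplitz_row_sum:
  fixes u :: "nat \<Rightarrow> 'a::comm_ring_1"
  assumes "t + L + R < n"
  shows "(\<Sum>k<n. banded_toeplitz n L R c $$ (t + L, k) * u k)
       = (\<Sum>m\<le>L + R. coeff (toeplitz_poly L R c) m * u (t + m))"
proof -
  have "(\<Sum>k<n. banded_toeplitz n L R c $$ (t + L, k) * u k)
      = (\<Sum>k\<in>{t..t + L + R}. c (int k - int t - int L) * u k)"
    using assms by (intro sum.mono_neutral_cong_right)
      (auto simp: banded_toeplitz_def diff_diff_eq)
  also have "\<dots> = (\<Sum>m\<le>L + R. coeff (toeplitz_poly L R c) m * u (t + m))"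
    by (rule sum.reindex_bij_witness[where i = "\<lambda>m. t + m" and j = "\<lambda>k. k - t"])
      (auto simp: coeff_toeplitz_poly of_nat_diff)
  finally show ?thesis .
qed

text \<open>Going down a column, the index of \<open>c\<close> decreases, hence the reversed
  argument of \<open>u\<close>.\<close>

lemma banded_toeplitz_col_sum:
  fixes u :: "nat \<Rightarrow> 'a::comm_ring_1"
  assumes "t + L + R < n"
  shows "(\<Sum>k<n. u k * banded_toeplitz n L R c $$ (k, t + R))
       = (\<Sum>m\<le>L + R. coeff (toeplitz_poly L R c) m * u (t + L + R - m))"
proof -
  have "(\<Sum>k<n. u k * banded_toeplitz n L R c $$ (k, t + R))
      = (\<Sum>k\<in>{t..t + L + R}. u k * c (int t + int R - int k))"
    using assms by (intro sum.mono_neutral_cong_right)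
      (auto simp: banded_toeplitz_def)
  also have "\<dots> = (\<Sum>m\<le>L + R. coeff (toeplitz_poly L R c) m * u (t + L + R - m))"
    by (rule sum.reindex_bij_witness[where i = "\<lambda>m. t + L + R - m" and j = "\<lambda>k. t + L + R - k"])
      (auto simp: coeff_toeplitz_poly of_nat_diff algebra_simps)
  finally show ?thesis .
qed

lemma index_mult_mat_sum:
  assumes "A \<in> carrier_mat m n" "B \<in> carrier_mat n l" "i < m" "j < l"
  shows "(A * B) $$ (i, j) = (\<Sum>k<n. A $$ (i, k) * B $$ (k, j))"
  using assms by (auto simp: scalar_prod_def lessThan_atLeast0 intro!: sum.cong)

lemma banded_toeplitz_inverse_row_shift:
  fixes c :: "int \<Rightarrow> 'a::idom"
  assumes N: "N \<in> carrier_mat n n" and inv: "banded_toeplitz n L R c * N = 1\<^sub>m n"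
    and R: "c (int R) \<noteq> 0" "1 \<le> R"
    and P: "toeplitz_poly L R c dvd monom 1 P - 1" "0 < P"
    and kl: "l < k" "k + P < n"
  shows "N $$ (k + P, l) = N $$ (k, l)"
proof -
  let ?f = "toeplitz_poly L R c"
  note deg = degree_toeplitz_poly[of c R L, OF R(1)]
  have "(\<lambda>s. N $$ (k + s, l)) P = (\<lambda>s. N $$ (k + s, l)) 0"
  proof (rule linear_recurrence_periodic[OF P])
    fix t assume "t + degree ?f \<le> P"
    then have t: "k + t + L + R < n" using kl deg by simp
    have "(\<Sum>m\<le>L + R. coeff ?f m * N $$ (k + t + m, l)) = (banded_toeplitz n L R c * N) $$ (k + t + L, l)"
      using t kl N by (subst index_mult_mat_sum[of _ n n _ n])
        (auto simp: banded_toeplitz_row_sum[OF t, where u = "\<lambda>k. N $$ (k, l)"] intro!: carrier_matI)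
    \<comment> \<open>Since \<open>l < k\<close>, this entry of the identity lies strictly below the
      diagonal.\<close>
    also have "\<dots> = 0" using t kl by (simp add: inv)
    finally show "(\<Sum>m\<le>degree ?f. coeff ?f m * N $$ (k + (t + m), l)) = 0"
      by (simp add: deg add.assoc)
  qed
  then show ?thesis by simp
qed

lemma banded_toeplitz_inverse_col_shift:
  fixes c :: "int \<Rightarrow> 'a::idom"
  assumes N: "N \<in> carrier_mat n n" and inv: "N * banded_toeplitz n L R c = 1\<^sub>m n"
    and R: "c (int R) \<noteq> 0" and L: "1 \<le> L"
    and P: "toeplitz_poly L R c dvd monom 1 P - 1" "0 < P"
    and kl: "l + P \<le> k" "k < n"
  shows "N $$ (k, l + P) = N $$ (k, l)"
proof -
  let ?f = "toeplitz_poly L R c"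
  note deg = degree_toeplitz_poly[of c R L, OF R]
  have "(\<lambda>s. N $$ (k, l + P - s)) P = (\<lambda>s. N $$ (k, l + P - s)) 0"
  proof (rule linear_recurrence_periodic[OF P])
    fix t assume "t + degree ?f \<le> P"
    then have t: "t + L + R \<le> P" using deg by simp
    \<comment> \<open>The window is read leftwards from column \<open>l + P - t\<close>, and
      \<open>s\<close> is its left end; by \<open>t\<close> the subtractions are exact.\<close>
    define s where "s = l + P - t - L - R"
    have s: "s + L + R + t = l + P" using t by (simp add: s_def)
    have "(\<Sum>m\<le>L + R. coeff ?f m * N $$ (k, s + L + R - m)) = (N * banded_toeplitz n L R c) $$ (k, s + R)"
      using s kl N by (subst index_mult_mat_sum[of _ n n _ n])
        (auto simp: banded_toeplitz_col_sum[where u = "\<lambda>l. N $$ (k, l)"] intro!: carrier_matI)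
    \<comment> \<open>\<open>1 \<le> L\<close> keeps column \<open>s + R\<close> strictly left of
      the diagonal even if \<open>k = l + P\<close> and \<open>t = 0\<close>.\<close>
    also have "\<dots> = 0" using s kl L by (simp add: inv)
    also have "s + L + R = l + P - t" using s by simp
    finally show "(\<Sum>m\<le>degree ?f. coeff ?f m * N $$ (k, l + P - (t + m))) = 0"
      by (simp add: deg)
  qed
  then show ?thesis by simp
qed

section \<open>Explicit entries of blocks and the computed inverse\<close>

lemma pick_atLeastLessThan:
  assumes "i < b - a"
  shows "pick {a..<b} i = a + i"
proof -
  have "{x \<in> {a..<b}. x < a + i} = {a..<a + i}" using assms by auto
  then show ?thesis using pick_card_in_set[of "a + i" "{a..<b}"] assms by simp
qed

lemma block_conv_mat:
  assumes "A \<in> carrier_mat n n"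
  shows "block P A i j = mat (min (i * P) n - (i - 1) * P) (min (j * P) n - (j - 1) * P)
           (\<lambda>(k, l). A $$ ((i - 1) * P + k, (j - 1) * P + l))"
proof -
  have "{x. x < n \<and> x \<in> {a..<min b n}} = {a..<min b n}" for a b by auto
  then show ?thesis using assms
    by (auto simp: block_def submatrix_def pick_atLeastLessThan intro!: cong_mat)
qed

lemma upper_rows_conv_mat:
  assumes "r \<le> dim_row A"
  shows "upper_rows r A = mat r (dim_col A) (\<lambda>(k, l). A $$ (k, l))"
proof -
  have "{i. i < dim_row A \<and> i < r} = {..<r}" using assms by auto
  moreover have "pick {..<r} i = i" if "i < r" for i
    using that pick_atLeastLessThan[of i r 0] by (simp add: atLeast0LessThan)
  ultimately show ?thesis
    by (auto simp: upper_rows_def submatrix_def pick_UNIV intro!: cong_mat)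
qed

lemma mat_inverse_invertible:
  fixes A :: "'a::field mat"
  assumes "invertible_mat A" "A \<in> carrier_mat n n"
  shows "A * the (mat_inverse A) = 1\<^sub>m n" "the (mat_inverse A) * A = 1\<^sub>m n"
    "the (mat_inverse A) \<in> carrier_mat n n"
proof -
  obtain B where B: "A * B = 1\<^sub>m n" "B * A = 1\<^sub>m (dim_row B)"
    using assms by (auto simp: invertible_mat_def inverts_mat_def)
  \<comment> \<open>Comparing column counts in the two identities recovers both dimensions of
    \<open>B\<close>, making \<open>A\<close> a unit of the matrix ring; this rules out
    \<open>None\<close>.\<close>
  have "B \<in> carrier_mat n n"
    using B assms(2) by (metis carrier_matD(2) carrier_matI index_mult_mat(3) index_one_mat(3))
  then have "A \<in> Units (ring_mat TYPE('a) n (undefined :: unit))"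
    using B assms(2) by (auto simp: Units_def ring_mat_def)
  then obtain N where "mat_inverse A = Some N"
    using mat_inverse(1)[OF assms(2), where b = "undefined :: unit"] by (cases "mat_inverse A") auto
  then show "A * the (mat_inverse A) = 1\<^sub>m n" "the (mat_inverse A) * A = 1\<^sub>m n"
    "the (mat_inverse A) \<in> carrier_mat n n"
    using mat_inverse(2)[OF assms(2)] by auto
qed

theorem theorem9:
  fixes c :: "int \<Rightarrow> 'p::prime_card mod_ring" and n L R :: nat
  assumes "1 \<le> L" and "1 \<le> R"
    and "c (- int L) \<noteq> 0" and "c (int R) \<noteq> 0"
    and "invertible_mat (banded_toeplitz n L R c)"
  shows "let P = poly_period (toeplitz_poly L R c);
             B = block P (the (mat_inverse (banded_toeplitz n L R c)))
         in (\<forall>i j. 1 \<le> j \<and> j < i \<and> i \<le> nat \<lfloor>real n / real P\<rfloor> \<longrightarrow> B i j = B 2 1) \<and>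
            (\<not> P dvd n \<longrightarrow>
              (\<forall>j. 1 \<le> j \<and> j \<le> nat \<lfloor>real n / real P\<rfloor> \<longrightarrow>
                B (nat \<lceil>real n / real P\<rceil>) j = upper_rows (n mod P) (B 2 1)))"
proof -
  define P where "P = poly_period (toeplitz_poly L R c)"
  define N where "N = the (mat_inverse (banded_toeplitz n L R c))"
  have "coeff (toeplitz_poly L R c) 0 \<noteq> 0" using assms(3) by (simp add: coeff_toeplitz_poly)
  then have P: "0 < P" "toeplitz_poly L R c dvd monom 1 P - 1"
    unfolding P_def by (fact poly_period)+
  have "banded_toeplitz n L R c \<in> carrier_mat n n" by (auto intro: carrier_matI)
  note N = mat_inverse_invertible[OF assms(5) this, folded N_def]
  note shift_row = banded_toeplitz_inverse_row_shift[OF N(3,1) assms(4,2) P(2,1)]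
  note shift_col = banded_toeplitz_inverse_col_shift[OF N(3,2) assms(4,1) P(2,1)]
  \<comment> \<open>Columns below \<open>P\<close> lie strictly left of the diagonal from row
    \<open>P\<close> on, so the second block row is the reference.\<close>
  have row: "N $$ (P * Suc a + k, l) = N $$ (P + k, l)"
    if "l < P" "P * Suc a + k < n" for a k l
    using that
  proof (induction a)
    case (Suc a)
    then show ?case using shift_row[of l "P * Suc a + k"] by (simp add: algebra_simps)
  qed simp
  \<comment> \<open>The bound on \<open>k\<close> places row \<open>k\<close> below the whole
    diagonal block \<open>b\<close>, counted from 0, so each shift to the left is
    legitimate.\<close>
  have col: "N $$ (k, P * b + l) = N $$ (k, l)" if "P * Suc b \<le> k" "k < n" "l < P" for b k l
    using that
  proof (induction b)
    case (Suc b)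
    then show ?case using shift_col[of "P * b + l" k] by (simp add: algebra_simps)
  qed simp
  \<comment> \<open>With block indices from 0: first move left to block column 0, then up to block
    row 1.\<close>
  have entry: "N $$ (P * i + k, P * j + l) = N $$ (P + k, l)"
    if "j < i" "l < P" "P * i + k < n" for i j k l
  proof -
    have "P * Suc j \<le> P * i" using that by (intro mult_le_mono) auto
    then have "N $$ (P * i + k, P * j + l) = N $$ (P * i + k, l)"
      using that by (intro col) auto
    also have "\<dots> = N $$ (P + k, l)" using that row[of l "i - 1" k] by (cases i) auto
    finally show ?thesis .
  qed
  have flr: "nat \<lfloor>real n / real P\<rfloor> = n div P" by (simp add: floor_divide_of_nat_eq)
  have ceil: "nat \<lceil>real n / real P\<rceil> = Suc (n div P)" if "\<not> P dvd n"
  proof -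
    have "real n / real P \<notin> \<int>"
    proof
      assume "real n / real P \<in> \<int>"
      then have "real n / real P = real_of_int \<lfloor>real n / real P\<rfloor>" by simp
      also have "\<dots> = real (n div P)" by (simp add: floor_divide_of_nat_eq)
      finally have "real n = real (n div P * P)" using P(1) by (simp add: field_simps)
      then have "n = n div P * P" by (simp only: of_nat_eq_iff)
      with that show False by (metis dvd_triv_right)
    qed
    then have "real n / real P \<noteq> real (n div P)" by (metis Ints_of_nat)
    then show ?thesis by (simp add: ceiling_altdef floor_divide_of_nat_eq nat_add_distrib)
  qed
  have main: "block P N i j = block P N 2 1" if h: "1 \<le> j" "j < i" "i \<le> n div P" for i j
  proof -
    obtain i' j' where ij: "i = Suc i'" "j = Suc j'" using h by (cases i; cases j) auto
    have le: "m * P \<le> n" if "m \<le> n div P" for m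
      using that by (simp add: less_eq_div_iff_mult_less_eq P(1))
    \<comment> \<open>All blocks involved are full, so every \<open>min\<close> disappears;
      \<open>2 \<le> n div P\<close> follows from \<open>1 \<le> j < i\<close>.\<close>
    have les: "Suc i' * P \<le> n" "Suc j' * P \<le> n" "2 * P \<le> n" "1 * P \<le> n"
      using h by (intro le; simp add: ij)+
    have "N $$ (i' * P + k, j' * P + l) = N $$ (P + k, l)" if "k < P" "l < P" for k l
      using entry[of j' i' l k] that h ij les by (simp add: mult.commute)
    then show ?thesis
      using les unfolding block_conv_mat[OF N(3)] ij by (auto simp: min_def intro!: cong_mat)
  qed
  have last: "block P N (Suc (n div P)) j = upper_rows (n mod P) (block P N 2 1)"
    if h: "1 \<le> j" "j \<le> n div P" for j
  proof -
    define q r where "q = n div P" and "r = n mod P"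
    have n: "n = q * P + r" by (simp add: q_def r_def)
    have r: "r < P" using P(1) by (simp add: r_def)
    obtain j' where j: "j = Suc j'" "j' < q" using h by (cases j) (auto simp: q_def)
    have jP: "Suc j' * P \<le> q * P" "1 * P \<le> q * P" using j by (intro mult_le_mono1; simp)+
    have ent: "N $$ (q * P + k, j' * P + l) = N $$ (P + k, l)" if "k < r" "l < P" for k l
      using entry[of j' q l k] that j n by (simp add: mult.commute)
    have "n \<le> Suc q * P" "Suc j' * P \<le> n" "1 * P \<le> n" using n r jP by simp_all
    then have mins: "min (Suc q * P) n = n" "min (Suc j' * P) n = Suc j' * P" "min (1 * P) n = P"
      by auto
    \<comment> \<open>If \<open>q = 1\<close>, block (2,1) is itself the truncated last block and
      has exactly \<open>r\<close> rows; in every case it has at least \<open>r\<close>.\<close>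
    have ge: "r \<le> min (2 * P) n - P" using n r jP by linarith
    have B21: "block P N 2 1 = mat (min (2 * P) n - P) P (\<lambda>(k, l). N $$ (P + k, l))"
      using mins(3) by (simp add: block_conv_mat[OF N(3)])
    have "block P N (Suc q) (Suc j') = mat r P (\<lambda>(k, l). N $$ (q * P + k, j' * P + l))"
      unfolding block_conv_mat[OF N(3)] mins(1,2) by (simp add: n)
    also have "\<dots> = upper_rows r (block P N 2 1)"
      unfolding B21 using ge by (subst upper_rows_conv_mat) (auto simp: ent intro!: cong_mat)
    finally show ?thesis by (simp add: q_def r_def j(1))
  qed
  show ?thesis
    unfolding Let_def P_def[symmetric] N_def[symmetric] flr
    using main last ceil by metis
qed

end
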